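(* For all integers $b\in\mathbb{N}$ and $\Delta\geq 3b$, there exists a digraph $D$ with $\tilde{\Delta}(D)=\Delta$, $\vec{\chi}(D)=\Delta-b+1$, and $\overset{\leftrightarrow}{\omega}(D)=\Delta-2b+1$.
   Context: Digraphs are finite, without loops and without parallel arcs; a pair of opposite arcs $uv,vu$ between the same two vertices is allowed. For a digraph $D$ with vertex set $V(D)$ and arc set $A(D)$, and $v\in V(D)$, the out-degree $d^+(v)$ and in-degree $d^-(v)$ are the numbers of out-neighbors and in-neighbors of $v$, respectively. Define the real number $$\tilde{\Delta}(D)=\max_{v\in V(D)}\sqrt{d^-(v)\cdot d^+(v)}.$$ A biclique of $D$ is a set $X$ of vertices inducing a complete digraph, i.e. $xy\in A(D)$ for all ordered pairs of distinct $x,y\in X$. The biclique number $\overset{\leftrightarrow}{\omega}(D)$ is the size of a largest biclique of $D$. A digraph is acyclic if it contains no directed cycle, where directed cycles have length at least $2$ (so a pair of opposite arcs is a directed cycle of length $2$). The dichromatic number $\vec{\chi}(D)$ is the smallest $k\in\mathbb{N}$ for which there is a partition $V_1,\dots,V_k$ of $V(D)$ such that the induced subdigraph $D[V_i]$ is acyclic for every $i\in\{1,\dots,k\}$. *)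

theory Defs
  imports Complex_Main "HOL-Library.Disjoint_Sets" "Graph_Theory.Graph_Theory"
begin

(* Digraphs are those of the locale digraph: finite, loopless, no parallel arcs, opposite arcs
   allowed. The absence of parallel arcs makes in_degree and out_degree, which count arcs, equal
   to the numbers of in-neighbours and out-neighbours. *)

(* Unspecified (Max of the empty set) if D has no vertices. *)
definition Delta_tilde :: "('a, 'b) pre_digraph \<Rightarrow> real" where
  "Delta_tilde D =
     Max ((\<lambda>v. sqrt (real (in_degree D v) * real (out_degree D v))) ` verts D)"

definition biclique :: "('a, 'b) pre_digraph \<Rightarrow> 'a set \<Rightarrow> bool" where
  "biclique D X \<longleftrightarrow> X \<subseteq> verts D \<and> (\<forall>x\<in>X. \<forall>y\<in>X. x \<noteq> y \<longrightarrow> x \<rightarrow>\<^bsub>D\<^esub> y)"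

definition biclique_number :: "('a, 'b) pre_digraph \<Rightarrow> nat" where
  "biclique_number D = Max (card ` {X. biclique D X})"

(* pre_digraph.cycle puts no lower bound of 2 on the length, but it only admits a
   cycle of length 1 at a loop, so there is none in a digraph. *)
definition acyclic_digraph :: "('a, 'b) pre_digraph \<Rightarrow> bool" where
  "acyclic_digraph D \<longleftrightarrow> \<not> (\<exists>p. pre_digraph.cycle D p)"

(* The parts of partition_on are nonempty; allowing empty parts would not change the minimum. *)
definition dichromatic_number :: "('a, 'b) pre_digraph \<Rightarrow> nat" where
  "dichromatic_number D =
     (LEAST k. \<exists>P. partition_on (verts D) P \<and> finite P \<and> card P = k \<and>
                   (\<forall>V\<in>P. acyclic_digraph (D \<restriction> V)))"

end

theory Submission
  imports Defs
begin

text \<open>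
  The extremal digraph is the join of \<open>b\<close> directed triangles and a complete digraph on
  \<open>\<Delta> + 1 - 3 * b\<close> vertices: take the complete digraph on \<open>\<Delta> + 1\<close> vertices, choose \<open>b\<close> disjoint
  triples, and keep in each of them only the arcs of a directed triangle. A directed triangle has
  three vertices, biclique number 1 and dichromatic number 2, and both parameters add up over a
  join; so each triple costs two in the biclique number and one in the dichromatic number compared
  with the complete digraph. The hypothesis \<open>\<Delta> \<ge> 3 * b\<close> leaves at least one vertex outside the
  triples, and such a vertex has in-degree and out-degree \<open>\<Delta>\<close>.

  Additivity over the join rests on one fact: vertices in different summands
  (\<^emph>\<open>blocks\<close>) are joined by arcs in both directions, while two vertices in the same block never
  are. Hence a biclique is a set with at most one vertex in each block, and an acyclic vertex set
  lies within a single block, of which it misses a vertex if that block is a triangle. A partition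
  into acyclic sets thus spends at least two parts on every triangle and at least one on every
  other vertex.
\<close>

section \<open>Acyclic digraphs\<close>

lemma not_acyclic_digon:
  assumes "tail D e = u" "head D e = v" "tail D f = v" "head D f = u"
    and "e \<in> arcs D" "f \<in> arcs D" "u \<in> verts D" "u \<noteq> v"
  shows "\<not> acyclic_digraph D"
proof -
  have "pre_digraph.cycle D [e, f]"
    unfolding pre_digraph.cycle_def pre_digraph.awalk_def
    using assms by (auto simp: pre_digraph.cas.simps pre_digraph.awalk_verts.simps)
  then show ?thesis by (auto simp: acyclic_digraph_def)
qed

lemma not_acyclic_triangle:
  assumes "tail D e = u" "head D e = v" "tail D f = v" "head D f = w" "tail D g = w" "head D g = u"
    and "e \<in> arcs D" "f \<in> arcs D" "g \<in> arcs D" "u \<in> verts D" "u \<noteq> v" "v \<noteq> w" "w \<noteq> u"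
  shows "\<not> acyclic_digraph D"
proof -
  have "pre_digraph.cycle D [e, f, g]"
    unfolding pre_digraph.cycle_def pre_digraph.awalk_def
    using assms by (auto simp: pre_digraph.cas.simps pre_digraph.awalk_verts.simps)
  then show ?thesis by (auto simp: acyclic_digraph_def)
qed

lemma acyclic_if_arcs_increase:
  fixes D :: "('a::preorder, 'b) pre_digraph"
  assumes inc: "\<And>e. e \<in> arcs D \<Longrightarrow> tail D e < head D e"
  shows "acyclic_digraph D"
proof -
  have "u \<le> v \<and> (p \<noteq> [] \<longrightarrow> u < v)" if "pre_digraph.cas D u p v" "set p \<subseteq> arcs D" for u p v
    using that
  proof (induction p arbitrary: u)
    case Nil
    then show ?case by (simp add: pre_digraph.cas.simps)
  next
    case (Cons e p)
    then have "u < head D e" "head D e \<le> v"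
      using inc[of e] by (auto simp: pre_digraph.cas.simps)
    then show ?case by (meson less_le_trans less_imp_le)
  qed
  then show ?thesis
    unfolding acyclic_digraph_def pre_digraph.cycle_def pre_digraph.awalk_def by (meson less_irrefl)
qed

section \<open>The join of directed triangles and a complete digraph\<close>

text \<open>
  The vertices below \<open>3 * b\<close> are grouped into consecutive triples, named by \<open>{..<b}\<close>; every other
  vertex is a block of its own and names itself.
\<close>
definition block :: "nat \<Rightarrow> nat \<Rightarrow> nat" where
  "block b v = (if v < 3 * b then v div 3 else v)"

text \<open>
  Within the triple \<open>i\<close>, the condition modulo 3 keeps exactly the arcs of the directed triangle
  \<open>3 * i \<rightarrow> 3 * i + 1 \<rightarrow> 3 * i + 2 \<rightarrow> 3 * i\<close>.
\<close>
definition joined_triangles :: "nat \<Rightarrow> nat \<Rightarrow> (nat, nat \<times> nat) pre_digraph" where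
  "joined_triangles b n =
     \<lparr>verts = {..n},
      arcs = {(u, v). u \<le> n \<and> v \<le> n \<and> u \<noteq> v \<and> (block b u = block b v \<longrightarrow> v mod 3 = Suc u mod 3)},
      tail = fst, head = snd\<rparr>"

lemma joined_triangles_simps [simp]:
  "verts (joined_triangles b n) = {..n}"
  "tail (joined_triangles b n) = fst"
  "head (joined_triangles b n) = snd"
  "(u, v) \<in> arcs (joined_triangles b n) \<longleftrightarrow>
     u \<le> n \<and> v \<le> n \<and> u \<noteq> v \<and> (block b u = block b v \<longrightarrow> v mod 3 = Suc u mod 3)"
  by (auto simp: joined_triangles_def)

lemma arcs_joined_triangles: "arcs (joined_triangles b n) \<subseteq> {..n} \<times> {..n}"
  by (auto simp: joined_triangles_def)

lemma dominates_joined_triangles [simp]: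
  "u \<rightarrow>\<^bsub>joined_triangles b n\<^esub> v \<longleftrightarrow> (u, v) \<in> arcs (joined_triangles b n)"
  by (auto simp: arcs_ends_def arc_to_ends_def)

lemma digraph_joined_triangles: "digraph (joined_triangles b n)"
proof
  show "finite (arcs (joined_triangles b n))"
    by (rule finite_subset[OF arcs_joined_triangles]) simp
qed (auto simp: arc_to_ends_def)

lemma block_eq_imp_in_triple:
  assumes "block b u = block b v" "u \<noteq> v"
  shows "v < 3 * b"
  using assms by (auto simp: block_def split: if_splits)

lemma not_both_successor_mod_3:
  fixes u v :: nat
  shows "\<not> (v mod 3 = Suc u mod 3 \<and> u mod 3 = Suc v mod 3)"
  by (auto simp: mod_Suc split: if_splits)

lemma block_image:
  assumes "3 * b \<le> Suc n"
  shows "block b ` {..n} = {..<b} \<union> {3 * b..n}"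
proof (intro equalityI subsetI)
  fix k assume k: "k \<in> {..<b} \<union> {3 * b..n}"
  show "k \<in> block b ` {..n}"
  proof (cases "k < b")
    case True
    then have "block b (3 * k) = k" "3 * k \<le> n" using assms by (auto simp: block_def)
    then show ?thesis by (metis atMost_iff imageI)
  next
    case False
    then have "block b k = k" "k \<le> n" using k by (auto simp: block_def)
    then show ?thesis by (metis atMost_iff imageI)
  qed
qed (auto simp: block_def)

lemma card_block_names:
  assumes "3 * b \<le> Suc n"
  shows "card ({..<b} \<union> {3 * b..n}) = Suc n - 2 * b"
  using assms by (subst card_Un_disjoint) auto

section \<open>Degrees\<close>

lemma out_degree_joined_triangles_le: "out_degree (joined_triangles b n) v \<le> n"
proof -
  have "out_arcs (joined_triangles b n) v \<subseteq> Pair v ` ({..n} - {v})"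
    by (auto simp: out_arcs_def)
  then have "out_degree (joined_triangles b n) v \<le> card ({..n} - {v})"
    unfolding out_degree_def by (metis surj_card_le finite_Diff finite_atMost)
  moreover have "out_degree (joined_triangles b n) v = 0" if "v > n"
    using that by (auto simp: out_degree_def out_arcs_def joined_triangles_def card_eq_0_iff)
  ultimately show ?thesis by (cases "v > n") auto
qed

lemma in_degree_joined_triangles_le: "in_degree (joined_triangles b n) v \<le> n"
proof -
  have "in_arcs (joined_triangles b n) v \<subseteq> (\<lambda>u. (u, v)) ` ({..n} - {v})"
    by (auto simp: in_arcs_def)
  then have "in_degree (joined_triangles b n) v \<le> card ({..n} - {v})"
    unfolding in_degree_def by (metis surj_card_le finite_Diff finite_atMost)
  moreover have "in_degree (joined_triangles b n) v = 0" if "v > n"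
    using that by (auto simp: in_degree_def in_arcs_def joined_triangles_def card_eq_0_iff)
  ultimately show ?thesis by (cases "v > n") auto
qed

lemma degree_outside_triangles:
  assumes "3 * b \<le> v" "v \<le> n"
  shows "out_degree (joined_triangles b n) v = n" "in_degree (joined_triangles b n) v = n"
proof -
  have other: "block b u \<noteq> block b v" if "u \<noteq> v" for u
    using block_eq_imp_in_triple[of b u v] that assms by auto
  have "out_arcs (joined_triangles b n) v = Pair v ` ({..n} - {v})"
    using assms other other[symmetric] by (auto simp: out_arcs_def)
  then show "out_degree (joined_triangles b n) v = n"
    using assms by (simp add: out_degree_def card_image inj_on_def)
  have "in_arcs (joined_triangles b n) v = (\<lambda>u. (u, v)) ` ({..n} - {v})"
    using assms other by (auto simp: in_arcs_def)
  then show "in_degree (joined_triangles b n) v = n"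
    using assms by (simp add: in_degree_def card_image inj_on_def)
qed

lemma Delta_tilde_joined_triangles:
  assumes "3 * b \<le> n"
  shows "Delta_tilde (joined_triangles b n) = real n"
  unfolding Delta_tilde_def
proof (rule Max_eqI)
  fix y
  assume "y \<in> (\<lambda>v. sqrt (real (in_degree (joined_triangles b n) v) *
      real (out_degree (joined_triangles b n) v))) ` verts (joined_triangles b n)"
  then obtain v where y: "y = sqrt (real (in_degree (joined_triangles b n) v) *
      real (out_degree (joined_triangles b n) v))"
    by auto
  have "y \<le> sqrt (real n * real n)"
    unfolding y using in_degree_joined_triangles_le out_degree_joined_triangles_le
    by (intro real_sqrt_le_mono mult_mono) auto
  then show "y \<le> real n" by simp
next
  show "real n \<in> (\<lambda>v. sqrt (real (in_degree (joined_triangles b n) v) *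
      real (out_degree (joined_triangles b n) v))) ` verts (joined_triangles b n)"
    using assms by (intro image_eqI[of _ _ "3 * b"]) (auto simp: degree_outside_triangles)
qed simp

section \<open>Bicliques\<close>

lemma biclique_joined_triangles_iff:
  "biclique (joined_triangles b n) X \<longleftrightarrow> X \<subseteq> {..n} \<and> inj_on (block b) X"
proof
  assume X: "biclique (joined_triangles b n) X"
  then have "x = y" if "x \<in> X" "y \<in> X" "block b x = block b y" for x y
    using that not_both_successor_mod_3[of y x] unfolding biclique_def by force
  then show "X \<subseteq> {..n} \<and> inj_on (block b) X"
    using X by (auto simp: biclique_def inj_on_def)
next
  assume X: "X \<subseteq> {..n} \<and> inj_on (block b) X"
  have "(x, y) \<in> arcs (joined_triangles b n)" if "x \<in> X" "y \<in> X" "x \<noteq> y" for x y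
  proof -
    have "x \<le> n" "y \<le> n" "block b x \<noteq> block b y"
      using X that by (blast, blast, meson inj_onD)
    then show ?thesis using that by simp
  qed
  then show "biclique (joined_triangles b n) X"
    using X unfolding biclique_def dominates_joined_triangles joined_triangles_simps(1) by blast
qed

lemma biclique_number_joined_triangles:
  assumes "3 * b \<le> Suc n"
  shows "biclique_number (joined_triangles b n) = Suc n - 2 * b"
  unfolding biclique_number_def
proof (rule Max_eqI)
  show "finite (card ` {X. biclique (joined_triangles b n) X})"
    by (rule finite_imageI, rule finite_subset[of _ "Pow {..n}"]) (auto simp: biclique_def)
next
  fix k assume "k \<in> card ` {X. biclique (joined_triangles b n) X}"
  then obtain X where X: "k = card X" "X \<subseteq> {..n}" "inj_on (block b) X"
    by (auto simp: biclique_joined_triangles_iff)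
  have "card X = card (block b ` X)" using X by (simp add: card_image)
  also have "\<dots> \<le> card (block b ` {..n})" using X by (intro card_mono) auto
  also have "\<dots> = Suc n - 2 * b" using assms by (simp add: block_image card_block_names)
  finally show "k \<le> Suc n - 2 * b" using X by simp
next
  \<comment> \<open>A largest biclique is a transversal of the blocks.\<close>
  obtain X where X: "X \<subseteq> {..n}" "inj_on (block b) X" "block b ` X = block b ` {..n}"
    by (metis subset_image_inj order_refl)
  then have "card X = Suc n - 2 * b"
    using assms by (metis card_image block_image card_block_names)
  then show "Suc n - 2 * b \<in> card ` {X. biclique (joined_triangles b n) X}"
    using X by (intro image_eqI[of _ _ X]) (simp_all only: biclique_joined_triangles_iff mem_Collect_eq)
qed

section \<open>Acyclic vertex sets\<close>

lemma acyclic_set_in_block: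
  assumes "acyclic_digraph (joined_triangles b n \<restriction> V)" "V \<subseteq> {..n}" "u \<in> V" "v \<in> V"
  shows "block b u = block b v"
proof (rule ccontr)
  assume "block b u \<noteq> block b v"
  then have "\<not> acyclic_digraph (joined_triangles b n \<restriction> V)"
    using assms by (intro not_acyclic_digon[of _ "(u, v)" u v "(v, u)"]) auto
  then show False using assms by simp
qed

lemma acyclic_set_misses_triangle_vertex:
  assumes "acyclic_digraph (joined_triangles b n \<restriction> V)" "V \<subseteq> {..n}"
  shows "\<not> {3 * i, 3 * i + 1, 3 * i + 2} \<subseteq> V"
proof
  assume sub: "{3 * i, 3 * i + 1, 3 * i + 2} \<subseteq> V"
  have mods: "(3 * i) mod 3 = 0" "Suc (3 * i) mod 3 = 1" "Suc (Suc (3 * i)) mod 3 = 2"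
    "Suc (Suc (Suc (3 * i))) mod 3 = 0"
    by (simp_all add: mod_Suc)
  have "\<not> acyclic_digraph (joined_triangles b n \<restriction> V)"
    using sub assms(2)
    by (intro not_acyclic_triangle[of _ "(3 * i, 3 * i + 1)" "3 * i" "3 * i + 1"
          "(3 * i + 1, 3 * i + 2)" "3 * i + 2" "(3 * i + 2, 3 * i)"])
       (auto simp: mods)
  then show False using assms by simp
qed

section \<open>Dichromatic number\<close>

text \<open>Sorting the parts by the block that contains them gives the lower bound.\<close>
lemma acyclic_partition_card_ge:
  assumes b: "3 * b \<le> Suc n"
    and P: "partition_on {..n} P" "finite P"
    and acyc: "\<And>V. V \<in> P \<Longrightarrow> acyclic_digraph (joined_triangles b n \<restriction> V)"
  shows "Suc n - b \<le> card P"
proof -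
  define parts where "parts k = {V \<in> P. \<exists>v\<in>V. block b v = k}" for k
  have sub: "V \<subseteq> {..n}" if "V \<in> P" for V
    using P that by (auto simp: partition_on_def)
  have ex_part: "\<exists>V\<in>P. v \<in> V" if "v \<le> n" for v
    using P that by (auto simp: partition_on_def)
  have disj: "parts k \<inter> parts l = {}" if "k \<noteq> l" for k l
    using that acyclic_set_in_block[OF acyc sub] by (auto simp: parts_def)
  have two: "2 \<le> card (parts k)" if "k < b" for k
  proof -
    have le: "3 * k + 2 \<le> n" using b that by simp
    then obtain V where V: "V \<in> P" "3 * k \<in> V" using ex_part[of "3 * k"] by auto
    obtain x where x: "x \<in> {3 * k, 3 * k + 1, 3 * k + 2}" "x \<notin> V"
      using acyclic_set_misses_triangle_vertex[OF acyc sub] V by blast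
    then obtain W where W: "W \<in> P" "x \<in> W" using ex_part[of x] le by auto
    have "block b (3 * k) = k" "block b x = k" using x that by (auto simp: block_def)
    then have "{V, W} \<subseteq> parts k" using V W by (auto simp: parts_def)
    moreover have "V \<noteq> W" using x W by blast
    then have "card {V, W} = 2" by simp
    ultimately show ?thesis using P(2) card_mono[of "parts k" "{V, W}"] by (auto simp: parts_def)
  qed
  have one: "1 \<le> card (parts k)" if k: "k \<in> {3 * b..n}" for k
  proof -
    obtain V where "V \<in> P" "k \<in> V" using ex_part k by auto
    moreover have "block b k = k" using k by (simp add: block_def)
    ultimately have "V \<in> parts k" by (auto simp: parts_def)
    then show ?thesis using P(2) card_gt_0_iff[of "parts k"] by (auto simp: parts_def Suc_le_eq)
  qed
  have "Suc n - b = (\<Sum>k\<in>{..<b}. 2) + (\<Sum>k\<in>{3 * b..n}. 1)" using b by simp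
  also have "\<dots> \<le> (\<Sum>k\<in>{..<b}. card (parts k)) + (\<Sum>k\<in>{3 * b..n}. card (parts k))"
    using two one by (intro add_mono sum_mono) auto
  also have "\<dots> = (\<Sum>k\<in>{..<b} \<union> {3 * b..n}. card (parts k))"
    by (rule sum.union_disjoint[symmetric]) auto
  also have "\<dots> = card (\<Union>k\<in>{..<b} \<union> {3 * b..n}. parts k)"
    using disj P(2) by (intro card_UN_disjoint[symmetric]) (auto simp: parts_def)
  also have "\<dots> \<le> card P" using P(2) by (intro card_mono) (auto simp: parts_def)
  finally show ?thesis .
qed

text \<open>
  For the upper bound, merge the first two vertices of every triple and leave all other vertices
  single. This saves one part for each triple.
\<close>
lemma acyclic_partition_exists:
  assumes b: "3 * b \<le> Suc n"
  obtains P where "partition_on {..n} P" "finite P" "card P = Suc n - b"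
    "\<And>V. V \<in> P \<Longrightarrow> acyclic_digraph (joined_triangles b n \<restriction> V)"
proof
  define c where "c v = (if v < 3 * b \<and> v mod 3 = 1 then v - 1 else v)" for v
  define part where "part r = {v. v \<le> n \<and> c v = r}" for r
  \<comment> \<open>\<open>c\<close> sends the second vertex of a triple to the first, so \<open>R\<close> is the range of \<open>c\<close>.\<close>
  define R where "R = {..n} - (\<lambda>i. 3 * i + 1) ` {..<b}"
  have img: "v \<in> (\<lambda>i. 3 * i + 1) ` {..<b} \<longleftrightarrow> v < 3 * b \<and> v mod 3 = 1" for v
  proof
    assume "v < 3 * b \<and> v mod 3 = 1"
    then have "v = 3 * (v div 3) + 1 \<and> v div 3 < b"
      using div_mult_mod_eq[of v 3] by linarith
    then show "v \<in> (\<lambda>i. 3 * i + 1) ` {..<b}" by blast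
  qed (auto simp: mod_Suc)
  have R: "r \<in> R \<longleftrightarrow> r \<le> n \<and> \<not> (r < 3 * b \<and> r mod 3 = 1)" for r
    unfolding R_def by (simp only: Diff_iff img atMost_iff)
  have self: "r \<in> part r" if "r \<in> R" for r
    using that by (auto simp: R part_def c_def)
  have cR: "c v \<in> R" if "v \<le> n" for v
  proof -
    have "\<not> (v - 1) mod 3 = 1" if "v mod 3 = 1"
      using that by (cases v) (auto simp: mod_Suc split: if_splits)
    then show ?thesis using that by (auto simp: R c_def)
  qed
  show "partition_on {..n} (part ` R)"
    unfolding partition_on_def disjoint_def using self cR by (auto simp: part_def)
  show "finite (part ` R)" by (simp add: R_def)
  have "inj_on part R"
  proof (rule inj_onI)
    fix r s assume "r \<in> R" "part r = part s"
    then have "r \<in> part s" using self by blast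
    then have "c r = s" by (simp add: part_def)
    moreover have "c r = r" using self[OF \<open>r \<in> R\<close>] by (simp add: part_def)
    ultimately show "r = s" by simp
  qed
  moreover have "card R = Suc n - b"
    unfolding R_def using b by (subst card_Diff_subset) (auto simp: card_image inj_on_def)
  ultimately show "card (part ` R) = Suc n - b" by (simp add: card_image)
  show "acyclic_digraph (joined_triangles b n \<restriction> V)" if "V \<in> part ` R" for V
  proof (rule acyclic_if_arcs_increase)
    fix e assume e: "e \<in> arcs (joined_triangles b n \<restriction> V)"
    obtain u v where uv: "e = (u, v)" by force
    have c: "c u = c v" "u \<noteq> v" and arc: "block b u = block b v \<longrightarrow> v mod 3 = Suc u mod 3"
      using e that by (auto simp: uv part_def)
    \<comment> \<open>Two vertices in one part are \<open>3 * i\<close> and \<open>3 * i + 1\<close>; a triangle has only the upward arc.\<close>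
    have "u < v"
    proof (rule ccontr)
      assume "\<not> u < v"
      then have u: "u = Suc v" "u < 3 * b" "u mod 3 = 1"
        using c by (auto simp: c_def split: if_splits)
      then have "u div 3 = v div 3" "v mod 3 = 0"
        by (auto simp: mod_Suc div_Suc split: if_splits)
      then show False using arc u by (simp add: block_def mod_Suc)
    qed
    then show "tail (joined_triangles b n \<restriction> V) e < head (joined_triangles b n \<restriction> V) e"
      by (simp add: uv)
  qed
qed

lemma dichromatic_number_joined_triangles:
  assumes "3 * b \<le> Suc n"
  shows "dichromatic_number (joined_triangles b n) = Suc n - b"
  unfolding dichromatic_number_def
proof (rule Least_equality)
  show "\<exists>P. partition_on (verts (joined_triangles b n)) P \<and> finite P \<and> card P = Suc n - b \<and>
      (\<forall>V\<in>P. acyclic_digraph (joined_triangles b n \<restriction> V))"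
    using acyclic_partition_exists[OF assms] by (metis joined_triangles_simps(1))
qed (use acyclic_partition_card_ge[OF assms] in auto)

section \<open>The three parameters together\<close>

theorem mainTheorem2:
  fixes b \<Delta> :: nat
  assumes "\<Delta> \<ge> 3 * b"
  shows "\<exists>D :: (nat, nat \<times> nat) pre_digraph.
           digraph D \<and>
           Delta_tilde D = real \<Delta> \<and>
           dichromatic_number D = \<Delta> - b + 1 \<and>
           biclique_number D = \<Delta> - 2 * b + 1"
  using assms
  by (intro exI[of _ "joined_triangles b \<Delta>"])
     (simp add: digraph_joined_triangles Delta_tilde_joined_triangles
        dichromatic_number_joined_triangles biclique_number_joined_triangles Suc_diff_le)

end
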